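(* For a fixed expected consolidation cycle length, HP1 performs better than TP1 and HP2 performs better than TP2 in terms of average order delay. That is, for all integers $q\ge 1$ and reals $T,T'>0$: (1) if HP1 with parameters $(q,T)$ and TP1 with parameter $T'$ have the same expected cycle length, i.e. $\mathbb{E}[\tau_q\wedge T]=T'$, then the average order delay of HP1 with parameters $(q,T)$ is strictly smaller than that of TP1 with parameter $T'$; (2) if HP2 with parameters $(q,T)$ and TP2 with parameter $T'$ have the same expected cycle length, i.e. $\mathbb{E}[\tau_q\wedge(\tau_1+T)]=\mathbb{E}[\tau_1+T']$, then the average order delay of HP2 with parameters $(q,T)$ is strictly smaller than that of TP2 with parameter $T'$.
   Context: Customer orders arrive according to a Poisson process $\{N(t)\}_{t\ge 0}$ with rate $\lambda>0$ and $N(0)=0$; $\tau_n$ denotes the arrival time of the $n$-th order, and $a\wedge b=\min(a,b)$. A renewal-type clearing policy is specified by its shipment-release time $\tau$ (the length of one consolidation cycle started at time $0$), a stopping time of the natural filtration of $N$ with $0<\mathbb{E}[\tau]<\infty$. Its expected cycle length is $\mathbb{E}[\tau]$ and its average order delay is $AOD_\tau=\mathbb{E}\left[\int_0^\tau N(u)\,du\right]/(\lambda\,\mathbb{E}[\tau])$. The policies are: TP1 with parameter $T>0$: $\tau=T$; TP2 with parameter $T>0$: $\tau=\tau_1+T$; HP1 with parameters $q\in\{1,2,\dots\}$, $T>0$: $\tau=\tau_q\wedge T$; HP2 with parameters $q\in\{1,2,\dots\}$, $T>0$: $\tau=\tau_q\wedge(\tau_1+T)$. *)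

theory Defs
  imports "HOL-Probability.Probability"
begin

text \<open>
  Only times \<open>t \<ge> 0\<close> matter. The paths are genuine counting paths (nondecreasing,
  right-continuous) for every outcome, so subtraction on \<^typ>\<open>nat\<close> never truncates
  in the increments below.
\<close>

locale poisson_process = prob_space M
  for M :: "'a measure" +
  fixes N :: "real \<Rightarrow> 'a \<Rightarrow> nat" and rate :: real
  assumes rate_pos: "0 < rate"
    and random_variable_N: "\<And>t. 0 \<le> t \<Longrightarrow> N t \<in> measurable M (count_space UNIV)"
    and start_zero: "\<And>\<omega>. \<omega> \<in> space M \<Longrightarrow> N 0 \<omega> = 0"
    and nondecreasing:
      "\<And>\<omega> s t. \<omega> \<in> space M \<Longrightarrow> 0 \<le> s \<Longrightarrow> s \<le> t \<Longrightarrow> N s \<omega> \<le> N t \<omega>"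
    and right_continuous:
      "\<And>\<omega> t. \<omega> \<in> space M \<Longrightarrow> 0 \<le> t \<Longrightarrow> continuous (at_right t) (\<lambda>u. N u \<omega>)"
    and independent_increments:
      "\<And>(n::nat) (t :: nat \<Rightarrow> real). 0 \<le> t 0 \<Longrightarrow> mono t \<Longrightarrow>
         indep_vars (\<lambda>_. count_space UNIV) (\<lambda>i \<omega>. N (t (Suc i)) \<omega> - N (t i) \<omega>) {..<n}"
    and poisson_increments:
      "\<And>s t. 0 \<le> s \<Longrightarrow> s < t \<Longrightarrow>
         distr M (count_space UNIV) (\<lambda>\<omega>. N t \<omega> - N s \<omega>) = measure_pmf (poisson_pmf (rate * (t - s)))"

text \<open>
  Random times are \<^typ>\<open>ennreal\<close>-valued: the arrival time is \<open>\<infinity>\<close> on the (null) set of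
  outcomes where the \<open>n\<close>-th order never arrives, since \<open>Inf {} = \<infinity>\<close>.
\<close>

definition arrival_time :: "(real \<Rightarrow> 'a \<Rightarrow> nat) \<Rightarrow> nat \<Rightarrow> 'a \<Rightarrow> ennreal" where
  "arrival_time N n \<omega> = Inf {ennreal t | t. 0 \<le> t \<and> n \<le> N t \<omega>}"

definition TP1 :: "real \<Rightarrow> 'a \<Rightarrow> ennreal" where
  "TP1 T \<omega> = ennreal T"

definition TP2 :: "(real \<Rightarrow> 'a \<Rightarrow> nat) \<Rightarrow> real \<Rightarrow> 'a \<Rightarrow> ennreal" where
  "TP2 N T \<omega> = arrival_time N 1 \<omega> + ennreal T"

definition HP1 :: "(real \<Rightarrow> 'a \<Rightarrow> nat) \<Rightarrow> nat \<Rightarrow> real \<Rightarrow> 'a \<Rightarrow> ennreal" where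
  "HP1 N q T \<omega> = min (arrival_time N q \<omega>) (ennreal T)"

definition HP2 :: "(real \<Rightarrow> 'a \<Rightarrow> nat) \<Rightarrow> nat \<Rightarrow> real \<Rightarrow> 'a \<Rightarrow> ennreal" where
  "HP2 N q T \<omega> = min (arrival_time N q \<omega>) (arrival_time N 1 \<omega> + ennreal T)"

text \<open>
  Expectations of nonnegative quantities are taken as \<^const>\<open>nn_integral\<close>, so that a
  divergent expectation is \<open>\<infinity>\<close> rather than the Bochner default \<open>0\<close>.
\<close>

definition expected_cycle_length :: "'a measure \<Rightarrow> ('a \<Rightarrow> ennreal) \<Rightarrow> ennreal" where
  "expected_cycle_length M \<tau> = (\<integral>\<^sup>+\<omega>. \<tau> \<omega> \<partial>M)"

definition cumulative_delay :: "(real \<Rightarrow> 'a \<Rightarrow> nat) \<Rightarrow> ('a \<Rightarrow> ennreal) \<Rightarrow> 'a \<Rightarrow> ennreal" where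
  "cumulative_delay N \<tau> \<omega> =
     (\<integral>\<^sup>+u\<in>{u. 0 \<le> u \<and> ennreal u \<le> \<tau> \<omega>}. of_nat (N u \<omega>) \<partial>lborel)"

definition average_order_delay ::
    "'a measure \<Rightarrow> (real \<Rightarrow> 'a \<Rightarrow> nat) \<Rightarrow> real \<Rightarrow> ('a \<Rightarrow> ennreal) \<Rightarrow> ennreal" where
  "average_order_delay M N rate \<tau> =
     (\<integral>\<^sup>+\<omega>. cumulative_delay N \<tau> \<omega> \<partial>M) / (ennreal rate * expected_cycle_length M \<tau>)"

end

theory Submission
  imports Defs
begin

text \<open>
  Every cost in the theorem is \<open>E (\<integral>\<^sub>0\<^sup>\<tau> f (N u) du)\<close>, with \<open>f = 1\<close> for the cycle length and
  \<open>f n = n\<close> for the total delay. By Tonelli it equals \<open>\<integral> E (f (N u); u < \<tau>) du\<close>. Since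
  \<open>u < \<tau>\<^sub>n\<close> means \<open>N u < n\<close>, capping a policy at \<open>\<tau>\<^sub>q\<close> amounts to replacing \<open>f\<close> by
  \<open>f \<cdot> 1{..<q}\<close>; and \<open>u < \<tau>\<^sub>1 + T\<close> means \<open>u < T\<close> or \<open>N (u - T) = 0\<close>. So independence of
  two increments replaces the strong Markov property, and everything reduces to the Poisson
  probabilities \<open>p\<^sub>k u = P (N u = k)\<close> (lemmas \<open>accumulated_TP1\<close>, \<open>accumulated_TP2\<close>).

  Write \<open>l\<close> for the rate, \<open>P\<^sub>k T = \<integral>\<^sub>0\<^sup>T p\<^sub>k\<close>, \<open>G\<^sub>q = \<Sum>k<q. P\<^sub>k\<close> and \<open>H\<^sub>q = \<Sum>k<q. k P\<^sub>k\<close>. The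
  pairs (expected cycle length, expected total delay) are:
  HP1 \<open>(G\<^sub>q T, H\<^sub>q T)\<close>;
  TP1 \<open>(T', l T'\<^sup>2 / 2)\<close>;
  HP2 \<open>(G\<^sub>q\<^sub>-\<^sub>1 T + 1 / l, H\<^sub>q\<^sub>-\<^sub>1 T + G\<^sub>q\<^sub>-\<^sub>1 T)\<close>;
  TP2 \<open>(T' + 1 / l, l T'\<^sup>2 / 2 + T')\<close>.
  Equal cycle lengths therefore mean \<open>T' = G\<^sub>r T\<close> with \<open>r = q\<close> in the first comparison and
  \<open>r = q - 1\<close> in the second, and as delays are then divided by the same number, both comparisons
  come down to the single inequality \<open>H\<^sub>r T < l (G\<^sub>r T)\<^sup>2 / 2\<close> for \<open>r > 0\<close>
  (\<open>sum_weighted_occupation_time_less\<close>). For \<open>q = 1\<close>, HP2 releases at the first arrival and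
  cannot have the same mean cycle length as TP2, whose \<open>T'\<close> is positive.

  Both sides of that inequality vanish at \<open>T = 0\<close>, so it suffices to compare derivatives:
  \<open>\<Sum>k<r. k p\<^sub>k < l G\<^sub>r \<cdot> (\<Sum>k<r. p\<^sub>k)\<close>. Here \<open>l G\<^sub>r u = E (min (N u) r)\<close>, because \<open>l E (\<tau>\<^sub>r \<and> u)\<close>
  is the mean number of orders up to \<open>\<tau>\<^sub>r \<and> u\<close>. After division by \<open>P (N u < r)\<close> the claim reads
  \<open>E (N u | N u < r) < E (min (N u) r)\<close>, which is clear: \<open>min (N u) r\<close> has the
  same law as \<open>N u\<close> on \<open>N u < r\<close> and exceeds all of those values elsewhere.
\<close>

section \<open>Poisson probabilities and their integrals\<close>

definition poisson_prob :: "real \<Rightarrow> nat \<Rightarrow> real \<Rightarrow> real" where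
  "poisson_prob l k u = (l * u) ^ k / fact k * exp (- (l * u))"

text \<open>
  Expected time that a Poisson process of rate \<open>l\<close> spends in state \<open>k\<close> before time \<open>u\<close>, in closed
  form. That this is the integral of \<^const>\<open>poisson_prob\<close> over \<open>[0, u]\<close> is the content of
  \<open>has_derivative_occupation_time\<close> and \<open>occupation_time_0\<close>.
\<close>

definition occupation_time :: "real \<Rightarrow> nat \<Rightarrow> real \<Rightarrow> real" where
  "occupation_time l k u = (1 - (\<Sum>j\<le>k. poisson_prob l j u)) / l"

lemma poisson_prob_pos: "0 < l \<Longrightarrow> 0 < u \<Longrightarrow> 0 < poisson_prob l k u"
  by (simp add: poisson_prob_def)

lemma poisson_prob_nonneg: "0 < l \<Longrightarrow> 0 \<le> u \<Longrightarrow> 0 \<le> poisson_prob l k u"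
  by (simp add: poisson_prob_def)

lemma poisson_prob_sums: "(\<lambda>k. poisson_prob l k u) sums 1"
proof -
  have "(\<lambda>k. (l * u) ^ k /\<^sub>R fact k * exp (- (l * u))) sums (exp (l * u) * exp (- (l * u)))"
    by (intro sums_mult2 exp_converges)
  then show ?thesis
    by (simp add: poisson_prob_def exp_minus field_simps)
qed

lemma Suc_times_poisson_prob:
  "real (Suc k) * poisson_prob l (Suc k) u = l * u * poisson_prob l k u"
  by (simp add: poisson_prob_def divide_simps del: of_nat_Suc)

lemma poisson_mean_sums: "(\<lambda>k. real k * poisson_prob l k u) sums (l * u)"
proof -
  have "(\<lambda>k. real (Suc k) * poisson_prob l (Suc k) u) sums (l * u * 1)"
    unfolding Suc_times_poisson_prob by (intro sums_mult poisson_prob_sums)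
  then show ?thesis
    by (subst (asm) sums_Suc_iff) simp
qed

lemma sum_poisson_prob_less_1:
  assumes "0 < l" "0 < u"
  shows "(\<Sum>k<n. poisson_prob l k u) < 1"
proof -
  have "(\<Sum>k<n. poisson_prob l k u) < (\<Sum>k. poisson_prob l k u)"
    using assms poisson_prob_sums
    by (intro sum_less_suminf) (auto simp: poisson_prob_pos sums_iff)
  then show ?thesis
    using poisson_prob_sums[of l u] by (simp add: sums_iff)
qed

text \<open>
  The probability of at most \<open>k\<close> arrivals decreases only through jumps from \<open>k\<close> to \<open>k + 1\<close>: the
  derivatives \<open>l (p\<^sub>j\<^sub>-\<^sub>1 - p\<^sub>j)\<close> telescope.
\<close>

lemma has_derivative_sum_poisson_prob:
  "((\<lambda>u. \<Sum>j\<le>k. poisson_prob l j u) has_real_derivative - l * poisson_prob l k u) (at u)"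
proof (induction k)
  case 0
  show ?case
    unfolding poisson_prob_def by (auto intro!: derivative_eq_intros)
next
  case (Suc k)
  have "(poisson_prob l (Suc k) has_real_derivative
          l * poisson_prob l k u - l * poisson_prob l (Suc k) u) (at u)"
    unfolding poisson_prob_def
    by (rule derivative_eq_intros refl | simp)+ (simp add: field_simps del: of_nat_Suc)
  from DERIV_add[OF Suc this] show ?case
    by simp
qed

lemma occupation_time_0 [simp]: "occupation_time l k 0 = 0"
proof -
  have "(\<Sum>j\<le>k. poisson_prob l j 0) = (\<Sum>j\<le>k. if j = 0 then 1 else 0)"
    by (intro sum.cong) (auto simp: poisson_prob_def)
  then show ?thesis
    by (simp add: occupation_time_def)
qed

lemma has_derivative_occupation_time:
  assumes "0 < l"
  shows "(occupation_time l k has_real_derivative poisson_prob l k u) (at u)"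
  using DERIV_cdivide[OF DERIV_diff[OF DERIV_const[of 1] has_derivative_sum_poisson_prob[of l k u]], of l]
    assms by (simp add: occupation_time_def[abs_def])

lemma has_derivative_weighted_occupation_time:
  assumes "0 < l"
  shows "((\<lambda>u. \<Sum>k<q. w k * occupation_time l k u) has_real_derivative
    (\<Sum>k<q. w k * poisson_prob l k u)) (at u)"
  by (intro DERIV_sum DERIV_cmult has_derivative_occupation_time assms)

lemma occupation_time_nonneg:
  assumes "0 < l" "0 \<le> u"
  shows "0 \<le> occupation_time l k u"
proof (cases "u = 0")
  case False
  then show ?thesis
    using sum_poisson_prob_less_1[of l u "Suc k"] assms
    by (simp add: occupation_time_def lessThan_Suc_atMost)
qed simp

text \<open>
  Wald's identity for the stopping time \<open>\<tau>\<^sub>q \<and> u\<close>: the left side is the rate times its mean, the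
  right side is \<open>E (min (N u) q)\<close>, the mean number of arrivals up to it.
\<close>

lemma sum_occupation_time:
  assumes "0 < l"
  shows "l * (\<Sum>k<q. occupation_time l k u) =
    real q * (1 - (\<Sum>k<q. poisson_prob l k u)) + (\<Sum>k<q. real k * poisson_prob l k u)"
proof (induction q)
  case (Suc q)
  have *: "l * occupation_time l q u = 1 - (\<Sum>k<q. poisson_prob l k u) - poisson_prob l q u"
    using assms by (simp add: occupation_time_def flip: lessThan_Suc_atMost)
  have "l * (\<Sum>k<Suc q. occupation_time l k u) =
      l * (\<Sum>k<q. occupation_time l k u) + l * occupation_time l q u"
    by (simp add: algebra_simps)
  then show ?case
    unfolding Suc.IH * by (simp add: algebra_simps)
qed simp

text \<open>
  With \<open>A = P (N u < q)\<close> and \<open>B = E (N u; N u < q)\<close>, the claim is \<open>B < (q (1 - A) + B) A\<close> by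
  the preceding identity, that is, \<open>B (1 - A) < q A (1 - A)\<close>. It holds because \<open>A < 1\<close> and every
  count entering \<open>B\<close> is smaller than \<open>q\<close>.
\<close>

lemma accrual_rate_less:
  assumes l: "0 < l" and u: "0 < u" and q: "0 < q"
  shows "(\<Sum>k<q. real k * poisson_prob l k u) <
    l * (\<Sum>k<q. occupation_time l k u) * (\<Sum>k<q. poisson_prob l k u)"
proof -
  define A B where "A = (\<Sum>k<q. poisson_prob l k u)" and "B = (\<Sum>k<q. real k * poisson_prob l k u)"
  have "A < 1"
    unfolding A_def by (rule sum_poisson_prob_less_1[OF l u])
  moreover have "B < real q * A"
    unfolding A_def B_def sum_distrib_left
    using q by (intro sum_strict_mono) (auto simp: poisson_prob_pos[OF l u])
  ultimately have "B * (1 - A) < real q * A * (1 - A)"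
    by simp
  then have "B < (real q * (1 - A) + B) * A"
    by (simp add: algebra_simps)
  then show ?thesis
    unfolding sum_occupation_time[OF l] by (simp add: A_def B_def)
qed

text \<open>
  The inequality behind both comparisons: with \<open>G\<close> the mean cycle length of the
  quantity-capped policy, the right side is the mean delay of the time-based policy of length
  \<open>G\<close>. The difference of the two sides starts at \<open>0\<close> and has a positive derivative by \<open>accrual_rate_less\<close>.
\<close>

lemma sum_weighted_occupation_time_less:
  assumes l: "0 < l" and T: "0 < T" and q: "0 < q"
  shows "(\<Sum>k<q. real k * occupation_time l k T) < l * (\<Sum>k<q. occupation_time l k T)\<^sup>2 / 2"
proof -
  define G H where "G u = (\<Sum>k<q. occupation_time l k u)"
    and "H u = (\<Sum>k<q. real k * occupation_time l k u)" for u
  define D where "D u = l * (G u)\<^sup>2 / 2 - H u" for u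
  have G: "(G has_real_derivative (\<Sum>k<q. poisson_prob l k u)) (at u)" for u
    using has_derivative_weighted_occupation_time[OF l, where w = "\<lambda>_. 1"]
    by (simp add: G_def[abs_def])
  have H: "(H has_real_derivative (\<Sum>k<q. real k * poisson_prob l k u)) (at u)" for u
    unfolding H_def[abs_def] by (rule has_derivative_weighted_occupation_time[OF l])
  have deriv: "(D has_real_derivative
      l * G u * (\<Sum>k<q. poisson_prob l k u) - (\<Sum>k<q. real k * poisson_prob l k u)) (at u)" for u
    unfolding D_def[abs_def] by (auto intro!: derivative_eq_intros G H)
  have "D 0 < D T"
  proof (rule DERIV_pos_imp_increasing_open[OF T])
    show "continuous_on {0..T} D"
      by (rule DERIV_continuous_on) (rule DERIV_subset[OF deriv subset_UNIV])
    show "\<exists>y. (D has_real_derivative y) (at u) \<and> 0 < y" if "0 < u" for u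
      using deriv[of u] accrual_rate_less[OF l that q, folded G_def]
      by (metis diff_gt_0_iff_gt)
  qed
  then show ?thesis
    by (simp add: D_def G_def H_def)
qed


section \<open>Arrival times and accumulated costs\<close>

context poisson_process
begin

text \<open>
  The translation between arrival times and counts. Right-continuity is essential: a count below
  \<open>n\<close> at time \<open>u\<close> stays below \<open>n\<close> on some interval beyond \<open>u\<close>, so the infimum defining the
  arrival time is strictly larger than \<open>u\<close>.
\<close>

lemma less_arrival_time_iff:
  assumes \<omega>: "\<omega> \<in> space M" and u: "0 \<le> u"
  shows "ennreal u < arrival_time N n \<omega> \<longleftrightarrow> N u \<omega> < n"
proof
  assume "ennreal u < arrival_time N n \<omega>"
  moreover have "arrival_time N n \<omega> \<le> ennreal u" if "n \<le> N u \<omega>"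
    unfolding arrival_time_def using that u by (intro Inf_lower) auto
  ultimately show "N u \<omega> < n"
    by (meson not_le)
next
  assume less: "N u \<omega> < n"
  have "((\<lambda>v. N v \<omega>) \<longlongrightarrow> N u \<omega>) (at_right u)"
    using right_continuous[OF \<omega> u] by (simp add: continuous_within)
  then have "eventually (\<lambda>v. N v \<omega> = N u \<omega>) (at_right u)"
    by (simp add: tendsto_discrete)
  then obtain b where b: "u < b" "\<And>v. u < v \<Longrightarrow> v < b \<Longrightarrow> N v \<omega> = N u \<omega>"
    by (auto simp: eventually_at_right_field)
  have "b \<le> t" if t: "0 \<le> t" "n \<le> N t \<omega>" for t
  proof (rule ccontr)
    assume "\<not> b \<le> t"
    then show False
      using b(2)[of t] nondecreasing[OF \<omega>, of t u] t less by (cases "u < t") auto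
  qed
  then have "ennreal b \<le> arrival_time N n \<omega>"
    unfolding arrival_time_def by (intro Inf_greatest) (auto intro!: ennreal_leI)
  then show "ennreal u < arrival_time N n \<omega>"
    using b(1) u by (meson ennreal_lessI less_le_trans le_less_trans)
qed

lemma measurable_arrival_time [measurable]: "arrival_time N n \<in> borel_measurable M"
proof (rule borel_measurableI_greater)
  fix y :: ennreal
  show "{\<omega> \<in> space M. y < arrival_time N n \<omega>} \<in> sets M"
  proof (cases y)
    case (real u)
    then have "{\<omega> \<in> space M. y < arrival_time N n \<omega>} = {\<omega> \<in> space M. N u \<omega> \<in> {..<n}}"
      by (auto simp: less_arrival_time_iff)
    then show ?thesis
      using random_variable_N[OF real(1)] by simp
  qed simp
qed

text \<open>
  Joint measurability, as needed for Tonelli, is not among the axioms of the process; it follows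
  since \<open>N u = n\<close> is expressed by the position of \<open>u\<close> relative to two measurable arrival times.
  Negative times, where paths are unconstrained, are sent to \<open>0\<close>.
\<close>

lemma measurable_count_pair:
  "(\<lambda>(u, \<omega>). N (max 0 u) \<omega>) \<in> measurable (lborel \<Otimes>\<^sub>M M) (count_space UNIV)"
  unfolding measurable_count_space_eq2_countable
proof (intro conjI ballI)
  fix n
  have "ennreal u < arrival_time N m \<omega> \<longleftrightarrow> N (max 0 u) \<omega> < m" if "\<omega> \<in> space M" for u m \<omega>
    using less_arrival_time_iff[OF that, of "max 0 u" m] by simp
  then have "(\<lambda>(u, \<omega>). N (max 0 u) \<omega>) -` {n} \<inter> space (lborel \<Otimes>\<^sub>M M) =
    {p \<in> space (lborel \<Otimes>\<^sub>M M). ennreal (fst p) < arrival_time N (Suc n) (snd p) \<and>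
      \<not> ennreal (fst p) < arrival_time N n (snd p)}"
    by (auto simp: space_pair_measure)
  also have "\<dots> \<in> sets (lborel \<Otimes>\<^sub>M M)"
    by measurable
  finally show "(\<lambda>(u, \<omega>). N (max 0 u) \<omega>) -` {n} \<inter> space (lborel \<Otimes>\<^sub>M M) \<in> sets (lborel \<Otimes>\<^sub>M M)" .
qed auto

text \<open>
  Expected cost of a cycle that is released at \<open>\<sigma>\<close> and incurs cost at rate \<open>f n\<close> while \<open>n\<close>
  orders have arrived. The strict bound \<open>u < \<sigma>\<close> is the one that arrival times translate
  into conditions on counts.
\<close>

definition accumulated :: "(nat \<Rightarrow> ennreal) \<Rightarrow> ('a \<Rightarrow> ennreal) \<Rightarrow> ennreal" where
  "accumulated f \<sigma> = (\<integral>\<^sup>+\<omega>. (\<integral>\<^sup>+u\<in>{u. 0 \<le> u \<and> ennreal u < \<sigma> \<omega>}. f (N u \<omega>) \<partial>lborel) \<partial>M)"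

lemma accumulated_eq:
  assumes [measurable]: "\<sigma> \<in> borel_measurable M"
  shows "accumulated f \<sigma> =
    (\<integral>\<^sup>+u\<in>{0..}. (\<integral>\<^sup>+\<omega>. f (N u \<omega>) * indicator {\<omega>. ennreal u < \<sigma> \<omega>} \<omega> \<partial>M) \<partial>lborel)"
proof -
  interpret pair_sigma_finite lborel M ..
  define g where "g u \<omega> = f (N (max 0 u) \<omega>) *
      indicator {p. 0 \<le> fst p \<and> ennreal (fst p) < \<sigma> (snd p)} (u, \<omega>)"
    for u \<omega>
  have [measurable]: "(\<lambda>p. f (N (max 0 (fst p)) (snd p))) \<in> borel_measurable (lborel \<Otimes>\<^sub>M M)"
    using measurable_compose[OF measurable_count_pair, of f borel] by (simp add: case_prod_beta)
  have "case_prod g \<in> borel_measurable (lborel \<Otimes>\<^sub>M M)"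
    unfolding g_def[abs_def] case_prod_beta by measurable
  note Fubini'[OF this]
  moreover have "accumulated f \<sigma> = (\<integral>\<^sup>+\<omega>. \<integral>\<^sup>+u. g u \<omega> \<partial>lborel \<partial>M)"
    unfolding accumulated_def g_def by (intro nn_integral_cong) (auto split: split_indicator simp: max_def)
  moreover have "(\<integral>\<^sup>+u. \<integral>\<^sup>+\<omega>. g u \<omega> \<partial>M \<partial>lborel) =
    (\<integral>\<^sup>+u\<in>{0..}. (\<integral>\<^sup>+\<omega>. f (N u \<omega>) * indicator {\<omega>. ennreal u < \<sigma> \<omega>} \<omega> \<partial>M) \<partial>lborel)"
    unfolding g_def by (intro nn_integral_cong) (auto split: split_indicator simp: max_def intro!: nn_integral_cong)
  ultimately show ?thesis
    by simp
qed

lemma emeasure_lborel_nonneg_reals: "emeasure lborel {0::real..} = \<infinity>"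
proof (cases "emeasure lborel {0::real..}")
  case (real r)
  have "emeasure lborel {0..r + 1} \<le> emeasure lborel {0::real..}"
    by (intro emeasure_mono) auto
  then show ?thesis
    using real by simp
qed simp

lemma nn_integral_below: "(\<integral>\<^sup>+u. indicator {u. 0 \<le> u \<and> ennreal u < t} u \<partial>lborel) = t"
proof (cases t)
  case (real r)
  have "{u. 0 \<le> u \<and> ennreal u < t} = {0..<r}"
    using real by (auto simp: ennreal_less_iff)
  then show ?thesis
    using real by simp
next
  case top
  have "{u::real. 0 \<le> u \<and> ennreal u < t} = {0..}"
    using top by auto
  then show ?thesis
    using top by (simp add: emeasure_lborel_nonneg_reals)
qed

lemma expected_cycle_length_eq: "expected_cycle_length M \<tau> = accumulated (\<lambda>_. 1) \<tau>"
  by (simp add: expected_cycle_length_def accumulated_def nn_integral_below)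

text \<open>
  The release instant itself, which the cumulative delay includes, is a single point and hence
  Lebesgue-null.
\<close>

lemma nn_integral_cumulative_delay:
  "(\<integral>\<^sup>+\<omega>. cumulative_delay N \<tau> \<omega> \<partial>M) = accumulated of_nat \<tau>"
  unfolding cumulative_delay_def accumulated_def
proof (rule nn_integral_cong, rule nn_integral_cong_AE)
  fix \<omega>
  have "AE u in lborel. u \<noteq> enn2real (\<tau> \<omega>)"
    by (rule AE_lborel_singleton)
  then show "AE u in lborel.
      of_nat (N u \<omega>) * indicator {u. 0 \<le> u \<and> ennreal u \<le> \<tau> \<omega>} u =
      (of_nat (N u \<omega>) * indicator {u. 0 \<le> u \<and> ennreal u < \<tau> \<omega>} u :: ennreal)"
  proof eventually_elim
    case (elim u)
    have "ennreal u \<noteq> \<tau> \<omega>" if "0 \<le> u"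
      using elim that by (metis enn2real_ennreal)
    then show ?case
      by (auto split: split_indicator simp: order.strict_iff_order)
  qed
qed

text \<open>
  Capping at the \<open>q\<close>-th arrival is absorbed into the cost rate, so that each hybrid policy becomes
  its time-based counterpart with a truncated cost.
\<close>

lemma accumulated_min_arrival_time:
  "accumulated f (\<lambda>\<omega>. min (arrival_time N q \<omega>) (\<sigma> \<omega>)) =
    accumulated (\<lambda>k. f k * indicator {..<q} k) \<sigma>"
  unfolding accumulated_def
  by (intro nn_integral_cong) (auto split: split_indicator simp: less_arrival_time_iff)

text \<open>
  \<open>E (f (N u))\<close> for \<open>u > 0\<close>. At \<open>u = 0\<close> the value is unspecified, since the Poisson
  distribution has a positive parameter; this single time is dropped below as a null set.
\<close>

definition poisson_mean :: "(nat \<Rightarrow> ennreal) \<Rightarrow> real \<Rightarrow> ennreal" where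
  "poisson_mean f u = (\<integral>\<^sup>+k. f k \<partial>measure_pmf (poisson_pmf (rate * u)))"

lemma measurable_increment [measurable]:
  "0 \<le> s \<Longrightarrow> s \<le> t \<Longrightarrow> (\<lambda>\<omega>. N t \<omega> - N s \<omega>) \<in> measurable M (count_space UNIV)"
  using random_variable_N[of s] random_variable_N[of t] by simp

lemma nn_integral_increment:
  assumes "0 \<le> s" "s < t"
  shows "(\<integral>\<^sup>+\<omega>. f (N t \<omega> - N s \<omega>) \<partial>M) = poisson_mean f (t - s)"
proof -
  have "(\<integral>\<^sup>+\<omega>. f (N t \<omega> - N s \<omega>) \<partial>M) =
      (\<integral>\<^sup>+k. f k \<partial>distr M (count_space UNIV) (\<lambda>\<omega>. N t \<omega> - N s \<omega>))"
    using assms by (subst nn_integral_distr) auto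
  then show ?thesis
    using assms by (simp add: poisson_increments poisson_mean_def)
qed

lemma nn_integral_count:
  assumes "0 < t"
  shows "(\<integral>\<^sup>+\<omega>. f (N t \<omega>) \<partial>M) = poisson_mean f t"
proof -
  have "(\<integral>\<^sup>+\<omega>. f (N t \<omega>) \<partial>M) = (\<integral>\<^sup>+\<omega>. f (N t \<omega> - N 0 \<omega>) \<partial>M)"
    by (intro nn_integral_cong) (simp add: start_zero)
  then show ?thesis
    using assms by (simp add: nn_integral_increment)
qed

text \<open>
  If nothing arrives before \<open>s\<close>, the count at \<open>t\<close> is the increment over \<open>(s, t]\<close>, which is
  independent of \<open>N s\<close>.
\<close>

lemma nn_integral_count_without_early_arrivals:
  assumes s: "0 < s" and t: "s < t"
  shows "(\<integral>\<^sup>+\<omega>. f (N t \<omega>) * indicator {\<omega>. N s \<omega> = 0} \<omega> \<partial>M) =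
    poisson_mean f (t - s) * ennreal (exp (- (rate * s)))"
proof -
  \<comment> \<open>The time grid \<open>0, s, t, t, \<dots>\<close>, whose first two increments are the relevant ones.\<close>
  define c :: "nat \<Rightarrow> real" where "c i = (if i = 0 then 0 else if i = 1 then s else t)" for i
  define g :: "nat \<Rightarrow> nat \<Rightarrow> ennreal" where "g i = (if i = 0 then indicator {0} else f)" for i
  have "0 \<le> c 0" "mono c"
    using s t by (auto simp: c_def intro!: monoI)
  then have "indep_vars (\<lambda>_. count_space UNIV) (\<lambda>i \<omega>. N (c (Suc i)) \<omega> - N (c i) \<omega>) {..<2}"
    by (rule independent_increments)
  then have "indep_vars (\<lambda>_. borel) (\<lambda>i \<omega>. g i (N (c (Suc i)) \<omega> - N (c i) \<omega>)) {..<2}"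
    by (rule indep_vars_compose2) simp
  then have "(\<integral>\<^sup>+\<omega>. (\<Prod>i<2. g i (N (c (Suc i)) \<omega> - N (c i) \<omega>)) \<partial>M) =
      (\<Prod>i<2. \<integral>\<^sup>+\<omega>. g i (N (c (Suc i)) \<omega> - N (c i) \<omega>) \<partial>M)"
    by (intro indep_vars_nn_integral) simp_all
  then have "(\<integral>\<^sup>+\<omega>. indicator {0} (N s \<omega> - N 0 \<omega>) * f (N t \<omega> - N s \<omega>) \<partial>M) =
      poisson_mean (indicator {0}) s * poisson_mean f (t - s)"
    using s t by (simp add: numeral_2_eq_2 lessThan_Suc c_def g_def nn_integral_increment ac_simps)
  moreover have "(\<integral>\<^sup>+\<omega>. indicator {0} (N s \<omega> - N 0 \<omega>) * f (N t \<omega> - N s \<omega>) \<partial>M) =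
      (\<integral>\<^sup>+\<omega>. f (N t \<omega>) * indicator {\<omega>. N s \<omega> = 0} \<omega> \<partial>M)"
    by (intro nn_integral_cong) (auto split: split_indicator simp: start_zero)
  moreover have "poisson_mean (indicator {0}) s = ennreal (exp (- (rate * s)))"
    using s rate_pos by (simp add: poisson_mean_def emeasure_pmf_single)
  ultimately show ?thesis
    by (simp add: mult.commute)
qed

section \<open>Costs of the four policies\<close>

text \<open>
  The mean cost rate \<open>e\<close> and its antiderivative \<open>F\<close> are parameters, so that the truncated
  and the untruncated cost rates are covered by the same evaluation.
\<close>

lemma accumulated_TP1:
  assumes T: "0 < T"
    and mean: "\<And>u. 0 < u \<Longrightarrow> poisson_mean f u = ennreal (e u)"
    and nonneg: "\<And>u. 0 \<le> u \<Longrightarrow> 0 \<le> e u"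
    and [measurable]: "e \<in> borel_measurable borel"
    and deriv: "\<And>u. (F has_real_derivative e u) (at u)"
  shows "accumulated f (TP1 T) = ennreal (F T - F 0)"
proof -
  have "accumulated f (TP1 T) =
      (\<integral>\<^sup>+u\<in>{0..}. (\<integral>\<^sup>+\<omega>. f (N u \<omega>) * indicator {\<omega>. ennreal u < TP1 T \<omega>} \<omega> \<partial>M) \<partial>lborel)"
    by (intro accumulated_eq) (simp add: TP1_def[abs_def])
  also have "\<dots> = (\<integral>\<^sup>+u\<in>{0..T}. ennreal (e u) \<partial>lborel)"
  proof (rule nn_integral_cong_AE)
    have "AE u in lborel. u \<noteq> 0 \<and> u \<noteq> T"
      using AE_lborel_singleton[of 0] AE_lborel_singleton[of T] by eventually_elim simp
    then show "AE u in lborel.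
        (\<integral>\<^sup>+\<omega>. f (N u \<omega>) * indicator {\<omega>. ennreal u < TP1 T \<omega>} \<omega> \<partial>M) * indicator {0..} u =
        ennreal (e u) * indicator {0..T} u"
      by eventually_elim
        (auto split: split_indicator simp: TP1_def ennreal_less_iff nn_integral_count mean)
  qed
  also have "\<dots> = ennreal (F T - F 0)"
    using T nonneg by (intro nn_integral_FTC_Icc DERIV_subset[OF deriv]) auto
  finally show ?thesis .
qed

text \<open>
  Up to time \<open>T\<close> the cycle is certainly running. At a later time \<open>u\<close> it is running exactly if there
  was no arrival up to \<open>u - T\<close>, which has probability \<open>exp (- rate (u - T))\<close>; the count then
  consists of the arrivals in a window of length \<open>T\<close>, with mean cost rate \<open>e T\<close>. Integrating the
  exponential gives the extra term \<open>e T / rate\<close>.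
\<close>

lemma accumulated_TP2:
  assumes T: "0 < T"
    and mean: "\<And>u. 0 < u \<Longrightarrow> poisson_mean f u = ennreal (e u)"
    and nonneg: "\<And>u. 0 \<le> u \<Longrightarrow> 0 \<le> e u"
    and [measurable]: "e \<in> borel_measurable borel"
    and deriv: "\<And>u. (F has_real_derivative e u) (at u)"
  shows "accumulated f (TP2 N T) = ennreal (F T - F 0 + e T / rate)"
proof -
  have "accumulated f (TP2 N T) =
      (\<integral>\<^sup>+u\<in>{0..}. (\<integral>\<^sup>+\<omega>. f (N u \<omega>) * indicator {\<omega>. ennreal u < TP2 N T \<omega>} \<omega> \<partial>M) \<partial>lborel)"
    by (intro accumulated_eq) (simp add: TP2_def[abs_def])
  also have "\<dots> = (\<integral>\<^sup>+u. ennreal (e u) * indicator {0..T} u +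
      ennreal (e T * exp (- (rate * (u - T)))) * indicator {T..} u \<partial>lborel)"
  proof (rule nn_integral_cong_AE)
    have "AE u in lborel. u \<noteq> 0 \<and> u \<noteq> T"
      using AE_lborel_singleton[of 0] AE_lborel_singleton[of T] by eventually_elim simp
    then show "AE u in lborel.
        (\<integral>\<^sup>+\<omega>. f (N u \<omega>) * indicator {\<omega>. ennreal u < TP2 N T \<omega>} \<omega> \<partial>M) * indicator {0..} u =
        ennreal (e u) * indicator {0..T} u +
        ennreal (e T * exp (- (rate * (u - T)))) * indicator {T..} u"
    proof eventually_elim
      case (elim u)
      consider "u < 0" | "0 < u" "u < T" | "T < u"
        using elim by linarith
      then show ?case
      proof cases
        case 1
        then show ?thesis using T by simp
      next
        case 2
        have "ennreal u < TP2 N T \<omega>" for \<omega>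
        proof -
          have "ennreal u < ennreal T"
            using 2 by (simp add: ennreal_less_iff)
          also have "\<dots> \<le> TP2 N T \<omega>"
            by (simp add: TP2_def)
          finally show ?thesis .
        qed
        then show ?thesis
          using 2 by (simp add: nn_integral_count mean)
      next
        case 3
        have "ennreal u < TP2 N T \<omega> \<longleftrightarrow> N (u - T) \<omega> = 0" if "\<omega> \<in> space M" for \<omega>
        proof -
          have "ennreal u < TP2 N T \<omega> \<longleftrightarrow> ennreal (u - T) + ennreal T < arrival_time N 1 \<omega> + ennreal T"
            using 3 T by (simp add: TP2_def flip: ennreal_plus)
          also have "\<dots> \<longleftrightarrow> ennreal (u - T) < arrival_time N 1 \<omega>"
            by (simp add: ennreal_add_left_cancel_less add.commute)
          finally show ?thesis
            using that 3 by (simp add: less_arrival_time_iff)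
        qed
        then have "(\<integral>\<^sup>+\<omega>. f (N u \<omega>) * indicator {\<omega>. ennreal u < TP2 N T \<omega>} \<omega> \<partial>M) =
            (\<integral>\<^sup>+\<omega>. f (N u \<omega>) * indicator {\<omega>. N (u - T) \<omega> = 0} \<omega> \<partial>M)"
          by (intro nn_integral_cong) (simp add: indicator_def)
        also have "\<dots> = ennreal (e T * exp (- (rate * (u - T))))"
          using 3 T nonneg[of T]
          by (simp add: nn_integral_count_without_early_arrivals mean ennreal_mult)
        finally show ?thesis
          using 3 T by simp
      qed
    qed
  qed
  also have "\<dots> = (\<integral>\<^sup>+u\<in>{0..T}. ennreal (e u) \<partial>lborel) +
      (\<integral>\<^sup>+u\<in>{T..}. ennreal (e T * exp (- (rate * (u - T)))) \<partial>lborel)"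
    by (intro nn_integral_add) simp_all
  also have "(\<integral>\<^sup>+u\<in>{0..T}. ennreal (e u) \<partial>lborel) = ennreal (F T - F 0)"
    using T nonneg by (intro nn_integral_FTC_Icc DERIV_subset[OF deriv]) auto
  also have "(\<integral>\<^sup>+u\<in>{T..}. ennreal (e T * exp (- (rate * (u - T)))) \<partial>lborel) =
      ennreal (0 - (- (e T / rate) * exp (- (rate * (T - T)))))"
  proof (rule nn_integral_FTC_atLeast[where F = "\<lambda>u. - (e T / rate) * exp (- (rate * (u - T)))"])
    have "filterlim (\<lambda>u. - (rate * (u - T))) at_bot at_top"
      using rate_pos by real_asymp
    then have "((\<lambda>u. exp (- (rate * (u - T)))) \<longlongrightarrow> 0) at_top"
      by (rule filterlim_compose[OF exp_at_bot])
    then show "((\<lambda>u. - (e T / rate) * exp (- (rate * (u - T)))) \<longlongrightarrow> 0) at_top"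
      by (rule tendsto_mult_right_zero)
    show "((\<lambda>u. - (e T / rate) * exp (- (rate * (u - T)))) has_real_derivative
        e T * exp (- (rate * (u - T)))) (at u)" for u
      using rate_pos by (auto intro!: derivative_eq_intros)
  qed (use nonneg T in auto)
  also have "ennreal (F T - F 0) + \<dots> = ennreal (F T - F 0 + e T / rate)"
  proof (subst ennreal_plus[symmetric])
    show "0 \<le> F T - F 0"
      using DERIV_nonneg_imp_nondecreasing[of 0 T F] T deriv nonneg by force
  qed (use nonneg[of T] T rate_pos in auto)
  finally show ?thesis .
qed

lemma poisson_mean_eq_suminf:
  assumes "0 < u"
  shows "poisson_mean f u = (\<Sum>k. ennreal (poisson_prob rate k u) * f k)"
  using assms rate_pos
  by (simp add: poisson_mean_def nn_integral_measure_pmf nn_integral_count_space_nat poisson_prob_def)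

lemma poisson_mean_1: "0 < u \<Longrightarrow> poisson_mean (\<lambda>_. 1) u = ennreal 1"
  by (simp add: poisson_mean_def)

lemma poisson_mean_of_nat:
  assumes "0 < u"
  shows "poisson_mean of_nat u = ennreal (rate * u)"
proof -
  have "poisson_mean of_nat u = (\<Sum>k. ennreal (real k * poisson_prob rate k u))"
    using assms rate_pos
    by (simp add: poisson_mean_eq_suminf ennreal_mult poisson_prob_nonneg ennreal_of_nat_eq_real_of_nat mult.commute)
  also have "\<dots> = ennreal (rate * u)"
    using assms rate_pos by (intro suminf_ennreal_eq poisson_mean_sums) (simp add: poisson_prob_nonneg)
  finally show ?thesis .
qed

lemma poisson_mean_below:
  assumes "0 < u" and "\<And>k. 0 \<le> w k"
  shows "poisson_mean (\<lambda>k. ennreal (w k) * indicator {..<q} k) u =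
    ennreal (\<Sum>k<q. w k * poisson_prob rate k u)"
proof -
  have "poisson_mean (\<lambda>k. ennreal (w k) * indicator {..<q} k) u =
      (\<Sum>k<q. ennreal (poisson_prob rate k u) * (ennreal (w k) * indicator {..<q} k))"
    unfolding poisson_mean_eq_suminf[OF assms(1)]
    by (intro suminf_finite) auto
  also have "\<dots> = (\<Sum>k<q. ennreal (w k * poisson_prob rate k u))"
    using assms rate_pos
    by (intro sum.cong) (auto simp: ennreal_mult poisson_prob_nonneg mult.commute)
  finally show ?thesis
    using assms rate_pos by (simp add: poisson_prob_nonneg)
qed


lemma has_derivative_half_square:
  "((\<lambda>u. rate * u\<^sup>2 / 2) has_real_derivative rate * u) (at u)"
  by (auto intro!: derivative_eq_intros)

lemma TP1_values:
  assumes "0 < T"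
  shows "accumulated (\<lambda>_. 1) (TP1 T) = ennreal T"
    and "accumulated of_nat (TP1 T) = ennreal (rate * T\<^sup>2 / 2)"
proof -
  show "accumulated (\<lambda>_. 1) (TP1 T) = ennreal T"
    using accumulated_TP1[OF assms, where f = "\<lambda>_. 1" and e = "\<lambda>_. 1" and F = "\<lambda>u. u"]
    by (simp add: poisson_mean_1)
  show "accumulated of_nat (TP1 T) = ennreal (rate * T\<^sup>2 / 2)"
    using has_derivative_half_square accumulated_TP1[OF assms, where f = of_nat and e = "\<lambda>u. rate * u"
      and F = "\<lambda>u. rate * u\<^sup>2 / 2"]
      rate_pos by (simp add: poisson_mean_of_nat)
qed

lemma TP2_values:
  assumes "0 < T"
  shows "accumulated (\<lambda>_. 1) (TP2 N T) = ennreal (T + 1 / rate)"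
    and "accumulated of_nat (TP2 N T) = ennreal (rate * T\<^sup>2 / 2 + T)"
proof -
  show "accumulated (\<lambda>_. 1) (TP2 N T) = ennreal (T + 1 / rate)"
    using accumulated_TP2[OF assms, where f = "\<lambda>_. 1" and e = "\<lambda>_. 1" and F = "\<lambda>u. u"]
    by (simp add: poisson_mean_1)
  show "accumulated of_nat (TP2 N T) = ennreal (rate * T\<^sup>2 / 2 + T)"
    using has_derivative_half_square accumulated_TP2[OF assms, where f = of_nat and e = "\<lambda>u. rate * u"
      and F = "\<lambda>u. rate * u\<^sup>2 / 2"]
      rate_pos by (simp add: poisson_mean_of_nat)
qed

lemma measurable_weighted_poisson_prob:
  "(\<lambda>u. \<Sum>k<q. w k * poisson_prob l k u) \<in> borel_measurable borel"
  unfolding poisson_prob_def by measurable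

text \<open>
  Weights \<open>w\<close> with real values keep the truncated means inside the real numbers, where the
  antiderivatives live.
\<close>

lemma accumulated_HP1:
  assumes "0 < T" and w: "\<And>k. 0 \<le> w k"
  shows "accumulated (\<lambda>k. ennreal (w k)) (HP1 N q T) =
    ennreal (\<Sum>k<q. w k * occupation_time rate k T)"
proof -
  have "accumulated (\<lambda>k. ennreal (w k)) (HP1 N q T) =
      accumulated (\<lambda>k. ennreal (w k) * indicator {..<q} k) (TP1 T)"
    by (simp add: HP1_def[abs_def] TP1_def[abs_def] accumulated_min_arrival_time)
  also have "\<dots> = ennreal ((\<Sum>k<q. w k * occupation_time rate k T) -
      (\<Sum>k<q. w k * occupation_time rate k 0))"
    using assms rate_pos
    by (intro accumulated_TP1[where e = "\<lambda>u. \<Sum>k<q. w k * poisson_prob rate k u"]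
        poisson_mean_below measurable_weighted_poisson_prob
        has_derivative_weighted_occupation_time sum_nonneg mult_nonneg_nonneg poisson_prob_nonneg)
  finally show ?thesis
    by simp
qed

lemma accumulated_HP2:
  assumes "0 < T" and w: "\<And>k. 0 \<le> w k"
  shows "accumulated (\<lambda>k. ennreal (w k)) (HP2 N q T) =
    ennreal ((\<Sum>k<q. w k * occupation_time rate k T) + (\<Sum>k<q. w k * poisson_prob rate k T) / rate)"
proof -
  have "accumulated (\<lambda>k. ennreal (w k)) (HP2 N q T) =
      accumulated (\<lambda>k. ennreal (w k) * indicator {..<q} k) (TP2 N T)"
    by (simp add: HP2_def[abs_def] TP2_def[abs_def] accumulated_min_arrival_time)
  also have "\<dots> = ennreal ((\<Sum>k<q. w k * occupation_time rate k T) -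
      (\<Sum>k<q. w k * occupation_time rate k 0) +
      (\<Sum>k<q. w k * poisson_prob rate k T) / rate)"
    using assms rate_pos
    by (intro accumulated_TP2[where e = "\<lambda>u. \<Sum>k<q. w k * poisson_prob rate k u"]
        poisson_mean_below measurable_weighted_poisson_prob
        has_derivative_weighted_occupation_time sum_nonneg mult_nonneg_nonneg poisson_prob_nonneg)
  finally show ?thesis
    by simp
qed

lemma HP1_values:
  assumes "0 < T"
  shows "accumulated (\<lambda>_. 1) (HP1 N q T) = ennreal (\<Sum>k<q. occupation_time rate k T)"
    and "accumulated of_nat (HP1 N q T) = ennreal (\<Sum>k<q. real k * occupation_time rate k T)"
  using accumulated_HP1[OF assms, where w = "\<lambda>_. 1" and q = q]
    accumulated_HP1[OF assms, where w = real and q = q]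
  by (simp_all flip: ennreal_of_nat_eq_real_of_nat)

text \<open>
  After the first arrival, the process restarts and HP2 with quantity \<open>r + 1\<close> runs as HP1 with
  quantity \<open>r\<close>, with one additional order waiting throughout. The formulas say so: the waiting
  time for the first order adds \<open>1 / rate\<close> to the cycle length and nothing to the delay, and
  the additional order adds the cycle length of HP1 to the delay. Algebraically, the boundary term
  of \<open>accumulated_HP2\<close> and the summand \<open>k = r\<close> add up to \<open>1 / rate\<close> for the length, and to the
  right side of \<open>sum_occupation_time\<close>, divided by the rate, for the delay.
\<close>

lemma HP2_values:
  assumes "0 < T"
  shows "accumulated (\<lambda>_. 1) (HP2 N (Suc r) T) = ennreal ((\<Sum>k<r. occupation_time rate k T) + 1 / rate)"
    and "accumulated of_nat (HP2 N (Suc r) T) =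
      ennreal ((\<Sum>k<r. real k * occupation_time rate k T) + (\<Sum>k<r. occupation_time rate k T))"
proof -
  have last: "occupation_time rate r T =
      (1 - (\<Sum>k<r. poisson_prob rate k T) - poisson_prob rate r T) / rate"
    by (simp add: occupation_time_def flip: lessThan_Suc_atMost)
  have "(\<Sum>k<Suc r. occupation_time rate k T) + (\<Sum>k<Suc r. poisson_prob rate k T) / rate =
      (\<Sum>k<r. occupation_time rate k T) + 1 / rate"
    using rate_pos by (simp add: last field_simps)
  then show "accumulated (\<lambda>_. 1) (HP2 N (Suc r) T) = ennreal ((\<Sum>k<r. occupation_time rate k T) + 1 / rate)"
    using accumulated_HP2[OF assms, where w = "\<lambda>_. 1" and q = "Suc r"]
    by (simp del: sum.lessThan_Suc)
  have "(\<Sum>k<Suc r. real k * occupation_time rate k T) + (\<Sum>k<Suc r. real k * poisson_prob rate k T) / rate =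
      (\<Sum>k<r. real k * occupation_time rate k T) +
      (real r * (1 - (\<Sum>k<r. poisson_prob rate k T)) + (\<Sum>k<r. real k * poisson_prob rate k T)) / rate"
    using rate_pos by (simp add: last field_simps)
  also have "\<dots> = (\<Sum>k<r. real k * occupation_time rate k T) + (\<Sum>k<r. occupation_time rate k T)"
    using rate_pos by (simp flip: sum_occupation_time)
  finally show "accumulated of_nat (HP2 N (Suc r) T) =
      ennreal ((\<Sum>k<r. real k * occupation_time rate k T) + (\<Sum>k<r. occupation_time rate k T))"
    using accumulated_HP2[OF assms, where w = real and q = "Suc r"]
    by (simp del: sum.lessThan_Suc flip: ennreal_of_nat_eq_real_of_nat)
qed

lemma average_order_delay_less:
  assumes L: "accumulated (\<lambda>_. 1) \<sigma> = ennreal L" "accumulated (\<lambda>_. 1) \<tau> = ennreal L" "0 < L"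
    and D: "accumulated of_nat \<sigma> = ennreal D" "accumulated of_nat \<tau> = ennreal E" "0 \<le> D" "D < E"
  shows "average_order_delay M N rate \<sigma> < average_order_delay M N rate \<tau>"
  using assms rate_pos
  by (simp add: average_order_delay_def expected_cycle_length_eq nn_integral_cumulative_delay
      divide_ennreal divide_strict_right_mono ennreal_lessI flip: ennreal_mult)

end

section \<open>Comparison of hybrid and time-based policies\<close>

theorem theorem5p3:
  fixes M :: "'a measure" and N :: "real \<Rightarrow> 'a \<Rightarrow> nat" and rate :: real
  assumes "poisson_process M N rate"
  shows "(\<forall>(q::nat) (T::real) (T'::real). q \<ge> 1 \<longrightarrow> T > 0 \<longrightarrow> T' > 0 \<longrightarrow>
            expected_cycle_length M (HP1 N q T) = expected_cycle_length M (TP1 T') \<longrightarrow>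
            average_order_delay M N rate (HP1 N q T) < average_order_delay M N rate (TP1 T'))
       \<and> (\<forall>(q::nat) (T::real) (T'::real). q \<ge> 1 \<longrightarrow> T > 0 \<longrightarrow> T' > 0 \<longrightarrow>
            expected_cycle_length M (HP2 N q T) = expected_cycle_length M (TP2 N T') \<longrightarrow>
            average_order_delay M N rate (HP2 N q T) < average_order_delay M N rate (TP2 N T'))"
proof -
  interpret poisson_process M N rate
    by (rule assms)
  define G H where "G q T = (\<Sum>k<q. occupation_time rate k T)"
    and "H q T = (\<Sum>k<q. real k * occupation_time rate k T)" for q T
  have nonneg: "0 \<le> G q T" "0 \<le> H q T" if "0 < T" for q T
    using that rate_pos by (auto simp: G_def H_def occupation_time_nonneg intro!: sum_nonneg)
  have H_less: "H q T < rate * (G q T)\<^sup>2 / 2" if "0 < q" "0 < T" for q T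
    unfolding G_def H_def using that rate_pos by (intro sum_weighted_occupation_time_less)
  show ?thesis
  proof (intro conjI allI impI)
    fix q :: nat and T T' :: real
    assume q: "q \<ge> 1" and T: "T > 0" and T': "T' > 0"
    note HP1 = HP1_values[OF T, folded G_def H_def]
    note TP1 = TP1_values[OF T']
    assume "expected_cycle_length M (HP1 N q T) = expected_cycle_length M (TP1 T')"
    then have "G q T = T'"
      using nonneg[OF T] T' by (simp add: expected_cycle_length_eq HP1 TP1)
    then show "average_order_delay M N rate (HP1 N q T) < average_order_delay M N rate (TP1 T')"
      using HP1[of q] TP1 T' nonneg[OF T] H_less[of q T] q T
      by (intro average_order_delay_less[where L = T' and D = "H q T" and E = "rate * T'\<^sup>2 / 2"]) auto
  next
    fix q :: nat and T T' :: real
    assume q: "q \<ge> 1" and T: "T > 0" and T': "T' > 0"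
    then obtain r where r: "q = Suc r"
      by (cases q) auto
    note HP2 = HP2_values[OF T, folded G_def H_def]
    note TP2 = TP2_values[OF T']
    assume "expected_cycle_length M (HP2 N q T) = expected_cycle_length M (TP2 N T')"
    then have eq: "G r T = T'"
      using nonneg[OF T] T' rate_pos by (simp add: expected_cycle_length_eq HP2 TP2 r)
    \<comment> \<open>\<open>r = 0\<close>, i.e. \<open>q = 1\<close>, would force \<open>T' = 0\<close>.\<close>
    then have "0 < r"
      using T' by (cases r) (simp_all add: G_def)
    then have "H r T + G r T < rate * T'\<^sup>2 / 2 + T'"
      using H_less[of r T] T eq by simp
    then show "average_order_delay M N rate (HP2 N q T) < average_order_delay M N rate (TP2 N T')"
      unfolding r using HP2[of r] TP2 T' nonneg[OF T] eq rate_pos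
      by (intro average_order_delay_less[where L = "T' + 1 / rate" and D = "H r T + G r T"
            and E = "rate * T'\<^sup>2 / 2 + T'"]) (auto simp: add_pos_pos)
  qed
qed

end
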